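(* A linear endomorphism $\varphi:(\mathbb{R}^{3},g_{Sol})\longrightarrow(\mathbb{R}^{3}, g_{Sol})$ of Sol space with $$\varphi (X)=\begin{pmatrix} a_{11} & a_{12} & a_{13}\\ a_{21} & a_{22} & a_{23}\\ a_{31} & a_{32} & a_{33}\end{pmatrix}\begin{pmatrix}x\\ y\\ z\end{pmatrix},\qquad a_{ij}\in\mathbb{R},$$ is $\infty$-harmonic if and only if $\varphi$ takes one of the following forms (with arbitrary real entries $a_{ij}$ where indicated): $$\varphi (X)=\begin{pmatrix}a_{11} & 0 & 0\\ 0 & a_{22} & 0\\ 0& 0 & 1\end{pmatrix}\begin{pmatrix}x\\ y\\ z\end{pmatrix},\qquad \varphi (X)=\begin{pmatrix}0 & a_{12} & 0\\ a_{21} & 0 & 0\\ 0& 0 & -1\end{pmatrix}\begin{pmatrix}x\\ y\\ z\end{pmatrix},$$ $$\varphi (X)=\begin{pmatrix}a_{11} & a_{12} & 0\\ a_{21} & a_{22} & 0\\ 0& 0 & 0\end{pmatrix}\begin{pmatrix}x\\ y\\ z\end{pmatrix},\qquad \varphi (X)=\begin{pmatrix}0 & 0& 0\\ 0 & 0& 0\\ 0 & 0 & a_{33}\end{pmatrix}\begin{pmatrix}x\\ y\\ z\end{pmatrix},$$ $$\varphi (X)=\begin{pmatrix}0 & 0 & 0\\ 0 & 0 & 0\\ a_{31}&a_{32}&0\end{pmatrix}\begin{pmatrix}x\\ y\\ z\end{pmatrix},\quad\text{or}\quad \varphi (X)=\begin{pmatrix}0 & 0& a_{13}\\ 0 & 0&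 a_{23}\\ 0& 0 & 0\end{pmatrix}\begin{pmatrix}x\\ y\\ z\end{pmatrix}.$$
   Context: A smooth map $\varphi:(M,g)\to(N,h)$ between Riemannian manifolds is called $\infty$-harmonic if $\mathrm{d}\varphi(\mathrm{grad}\,|\mathrm{d}\varphi|^2)=0$ on $M$, where $|\mathrm{d}\varphi|^2=\mathrm{Trace}_g\,\varphi^*h$ is the energy density of $\varphi$ and $\mathrm{grad}$ is the gradient with respect to $g$. Sol space is $(\mathbb{R}^3,g_{Sol})$, where in the standard coordinates $(x,y,z)$ of $\mathbb{R}^3$: $g_{Sol}=e^{2z}\mathrm{d}x^2+e^{-2z}\mathrm{d}y^2+\mathrm{d}z^2$. A linear endomorphism of Sol space means a map $\mathbb{R}^3\to\mathbb{R}^3$ that is linear in these standard coordinates (not necessarily invertible, and not required to respect any other group structure). *)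

theory Defs
  imports "HOL-Analysis.Analysis"
begin

primrec times_differentiable ::
  "nat \<Rightarrow> ('a::euclidean_space \<Rightarrow> 'b::real_normed_vector) \<Rightarrow> bool" where
  "times_differentiable 0 f \<longleftrightarrow> continuous_on UNIV f"
| "times_differentiable (Suc k) f \<longleftrightarrow>
     (\<forall>p. f differentiable (at p)) \<and>
     (\<forall>v. times_differentiable k (\<lambda>p. frechet_derivative f (at p) v))"

definition smooth :: "('a::euclidean_space \<Rightarrow> 'b::real_normed_vector) \<Rightarrow> bool" where
  "smooth f \<longleftrightarrow> (\<forall>k. times_differentiable k f)"

text \<open>
  A Riemannian metric on \<open>\<real>\<^sup>n\<close> is represented by its Gram matrix field in the standard
  coordinates: the entry \<open>g p $ i $ j\<close> is the inner product of the \<open>i\<close>-th and \<open>j\<close>-th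
  coordinate vector fields at \<open>p\<close>. Tangent spaces are identified with \<open>\<real>\<^sup>n\<close>, so the
  differential of a map is its Frechet derivative.
\<close>

type_synonym 'n gram_field = "real ^ 'n \<Rightarrow> real ^ 'n ^ 'n"

definition metric_inner ::
  "'n::finite gram_field \<Rightarrow> real ^ 'n \<Rightarrow> real ^ 'n \<Rightarrow> real ^ 'n \<Rightarrow> real" where
  "metric_inner g p u v = u \<bullet> (g p *v v)"

definition riemannian_metric :: "'n::finite gram_field \<Rightarrow> bool" where
  "riemannian_metric g \<longleftrightarrow>
     smooth g \<and>
     (\<forall>p u v. metric_inner g p u v = metric_inner g p v u) \<and>
     (\<forall>p u. u \<noteq> 0 \<longrightarrow> metric_inner g p u u > 0)"

definition pullback_metric ::
  "(real ^ 'm::finite \<Rightarrow> real ^ 'n::finite) \<Rightarrow> 'n gram_field \<Rightarrow>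
   real ^ 'm \<Rightarrow> real ^ 'm \<Rightarrow> real ^ 'm \<Rightarrow> real" where
  "pullback_metric \<phi> h p u v =
     metric_inner h (\<phi> p) (frechet_derivative \<phi> (at p) u) (frechet_derivative \<phi> (at p) v)"

definition metric_trace ::
  "'m::finite gram_field \<Rightarrow> real ^ 'm \<Rightarrow> (real ^ 'm \<Rightarrow> real ^ 'm \<Rightarrow> real) \<Rightarrow> real" where
  "metric_trace g p b =
     (\<Sum>i\<in>UNIV. \<Sum>j\<in>UNIV. matrix_inv (g p) $ i $ j * b (axis i 1) (axis j 1))"

text \<open>There is no factor \<open>1/2\<close> in the energy density.\<close>

definition energy_density ::
  "'m::finite gram_field \<Rightarrow> 'n::finite gram_field \<Rightarrow>
   (real ^ 'm \<Rightarrow> real ^ 'n) \<Rightarrow> real ^ 'm \<Rightarrow> real" where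
  "energy_density g h \<phi> p = metric_trace g p (pullback_metric \<phi> h p)"

definition gradient ::
  "'m::finite gram_field \<Rightarrow> (real ^ 'm \<Rightarrow> real) \<Rightarrow> real ^ 'm \<Rightarrow> real ^ 'm" where
  "gradient g f p = (THE w. \<forall>u. metric_inner g p w u = frechet_derivative f (at p) u)"

text \<open>Meaningful when \<open>g\<close> and \<open>h\<close> are Riemannian metrics.\<close>

definition infinity_harmonic ::
  "'m::finite gram_field \<Rightarrow> 'n::finite gram_field \<Rightarrow> (real ^ 'm \<Rightarrow> real ^ 'n) \<Rightarrow> bool" where
  "infinity_harmonic g h \<phi> \<longleftrightarrow>
     smooth \<phi> \<and>
     (\<forall>p. frechet_derivative \<phi> (at p) (gradient g (energy_density g h \<phi>) p) = 0)"

definition sol_metric :: "3 gram_field" where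
  "sol_metric p = vector
     [vector [exp (2 * p $ 3), 0, 0],
      vector [0, exp (- 2 * p $ 3), 0],
      vector [0, 0, 1]]"

lemma metric_inner_sol:
  "metric_inner sol_metric p u v =
     exp (2 * p $ 3) * u $ 1 * v $ 1 + exp (- 2 * p $ 3) * u $ 2 * v $ 2 + u $ 3 * v $ 3"
  by (simp add: metric_inner_def sol_metric_def inner_vec_def matrix_vector_mult_def
      sum_3)

lemma times_differentiable_exp_sum:
  fixes C D E :: "'b::real_normed_vector"
  shows "times_differentiable k
    (\<lambda>p::real^3. exp (2 * p $ 3) *\<^sub>R C + exp (- 2 * p $ 3) *\<^sub>R D + E)"
proof (induction k arbitrary: C D E)
  case 0
  show ?case
    unfolding times_differentiable.simps by (intro continuous_intros)
next
  case (Suc k)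
  let ?f = "\<lambda>p::real^3. exp (2 * p $ 3) *\<^sub>R C + exp (- 2 * p $ 3) *\<^sub>R D + E"
  let ?f' = "\<lambda>(p::real^3) (v::real^3). exp (2 * p $ 3) *\<^sub>R ((2 * v $ 3) *\<^sub>R C)
      + exp (- 2 * p $ 3) *\<^sub>R ((- 2 * v $ 3) *\<^sub>R D) + 0"
  have exp_der: "((\<lambda>p::real^3. exp (c * p $ 3)) has_derivative
      (\<lambda>v. exp (c * p $ 3) * (c * v $ 3))) (at p)" for c p
    by (rule has_derivative_exp[THEN has_derivative_eq_rhs],
        rule has_derivative_mult_right[OF bounded_linear_imp_has_derivative[OF bounded_linear_vec_nth]])
      (simp add: fun_eq_iff)
  have der: "(?f has_derivative ?f' p) (at p)" for p
    using has_derivative_add[OF has_derivative_add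
        [OF has_derivative_scaleR_left[OF exp_der[of 2 p], of C]
            has_derivative_scaleR_left[OF exp_der[of "- 2" p], of D]]
        has_derivative_const[of E "at p"]]
    unfolding scaleR_scaleR .
  have fre: "frechet_derivative ?f (at p) = ?f' p" for p
    by (rule frechet_derivative_at[OF der, symmetric])
  show ?case
    unfolding times_differentiable.simps fre
  proof (intro conjI allI)
    show "?f differentiable (at p)" for p
      by (rule differentiableI[OF der])
    show "times_differentiable k (\<lambda>p::real^3. ?f' p v)" for v
      by (rule Suc)
  qed
qed

lemma riemannian_metric_sol: "riemannian_metric sol_metric"
  unfolding riemannian_metric_def
proof (intro conjI allI impI)
  have eq: "sol_metric =
    (\<lambda>p. exp (2 * p $ 3) *\<^sub>R vector [vector [1, 0, 0], 0, 0]
       + exp (- 2 * p $ 3) *\<^sub>R vector [0, vector [0, 1, 0], 0]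
       + vector [0, 0, vector [0, 0, 1]])"
    by (simp add: fun_eq_iff vec_eq_iff forall_3 sol_metric_def)
  show "smooth sol_metric"
    unfolding smooth_def eq by (intro allI times_differentiable_exp_sum)
next
  fix p u v
  show "metric_inner sol_metric p u v = metric_inner sol_metric p v u"
    by (simp add: metric_inner_sol)
next
  fix p u :: "real^3"
  assume "u \<noteq> 0"
  then have "u $ 1 \<noteq> 0 \<or> u $ 2 \<noteq> 0 \<or> u $ 3 \<noteq> 0"
    by (auto simp: vec_eq_iff forall_3)
  moreover have "exp c * (a * a) \<ge> 0" "exp c * (a * a) > 0 \<longleftrightarrow> a \<noteq> 0"
    "a * a \<ge> 0" "a * a > 0 \<longleftrightarrow> a \<noteq> 0" for a c :: real
    by (auto simp: zero_less_mult_iff)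
  ultimately show "metric_inner sol_metric p u u > 0"
    unfolding metric_inner_sol mult.assoc
    by (metis add_nonneg_nonneg add_nonneg_pos add_pos_nonneg)
qed

end

(*
  For a linear map with matrix A the energy density is a combination of exponentials in z and
  in the third coordinate w of the image point, and the equation becomes one scalar identity
  per row of A.  If a31 or a32 is nonzero, z and w vary independently, so comparing the
  coefficients of exp (2w), exp (-2w) and 1 kills a33 and the first two rows.  Otherwise
  w = a33 z, and either the third column vanishes or the energy density, now a function of z
  only, is constant.  It is a sum of exponentials with nonnegative coefficients, so its second
  derivative at 0 is a sum of squares, which forces every nonconstant exponential to have
  coefficient 0.
*)

theory Submission
  imports Defs
begin

section \<open>Smoothness and differentials of linear maps\<close>

text \<open>The constant \<open>c\<close> makes the induction close: a directional derivative of an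
  affine map is the constant \<open>L v\<close>, that is, the zero map plus
  \<open>L v\<close>.\<close>

lemma times_differentiable_affine:
  fixes L :: "'a::euclidean_space \<Rightarrow> 'b::real_normed_vector"
  assumes "bounded_linear L"
  shows "times_differentiable k (\<lambda>p. L p + c)"
  using assms
proof (induction k arbitrary: L c)
  case 0
  then show ?case
    by (simp add: continuous_on_add linear_continuous_on)
next
  case (Suc k)
  have der: "((\<lambda>p. L p + c) has_derivative L) (at p)" for p
    using Suc.prems by (intro has_derivative_add_const bounded_linear_imp_has_derivative)
  have fre: "frechet_derivative (\<lambda>p. L p + c) (at p) = L" for p
    by (rule frechet_derivative_at[OF der, symmetric])
  have "times_differentiable k (\<lambda>p::'a. L v)" for v
    using Suc.IH[OF bounded_linear_zero, of "L v"] by simp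
  with der show ?case
    unfolding times_differentiable.simps fre by (auto intro: differentiableI)
qed

lemma smooth_linear:
  assumes "bounded_linear L"
  shows "smooth L"
  using times_differentiable_affine[OF assms, of _ 0] by (simp add: smooth_def)

lemma frechet_derivative_matrix_vector_mult:
  fixes A :: "real^'n^'m"
  shows "frechet_derivative (\<lambda>X. A *v X) (at p) = (\<lambda>X. A *v X)"
  using bounded_linear_imp_has_derivative[OF matrix_vector_mul_bounded_linear]
  by (rule frechet_derivative_at[symmetric])

section \<open>Inverse Gram matrix and gradient in Sol space\<close>

lemma matrix_inv_unique:
  fixes A B :: "'a::semiring_1^'n^'n"
  assumes "A ** B = mat 1" "B ** A = mat 1"
  shows "matrix_inv A = B"
proof -
  have inv: "matrix_inv A ** A = mat 1"
    unfolding matrix_inv_def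
    by (rule someI2[where a = B and P = "\<lambda>C. A ** C = mat 1 \<and> C ** A = mat 1"])
      (use assms in blast)+
  have "matrix_inv A = matrix_inv A ** (A ** B)"
    by (simp add: assms(1))
  also have "\<dots> = matrix_inv A ** A ** B"
    by (rule matrix_mul_assoc)
  finally show ?thesis
    by (simp add: inv)
qed

lemma matrix_inv_sol_metric:
  "matrix_inv (sol_metric p) = vector
     [vector [exp (- 2 * p $ 3), 0, 0],
      vector [0, exp (2 * p $ 3), 0],
      vector [0, 0, 1]]"
    (is "_ = ?B")
proof (rule matrix_inv_unique)
  show "sol_metric p ** ?B = mat 1" "?B ** sol_metric p = mat 1"
    by (simp_all add: vec_eq_iff[of _ "mat 1"] vec_eq_iff[of _ "mat 1 $ _"] forall_3
        matrix_matrix_mult_def sum_3)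
      (simp_all add: mat_def sol_metric_def exp_minus)
qed

text \<open>Raising the index with the diagonal inverse metric gives the vector; testing against the
  coordinate vectors shows it is the only one, as the definite description in
  \<open>gradient\<close> demands.\<close>

lemma gradient_sol_metric:
  assumes "(f has_derivative D) (at p)"
  shows "gradient sol_metric f p = vector
     [exp (- 2 * p $ 3) * D (axis 1 1), exp (2 * p $ 3) * D (axis 2 1), D (axis 3 1)]"
    (is "_ = ?w")
proof -
  have fre: "frechet_derivative f (at p) = D"
    by (rule frechet_derivative_at[OF assms, symmetric])
  have lin: "linear D"
    using assms by (rule has_derivative_linear)
  have cancel: "exp (2 * p $ 3) * (exp (- (2 * p $ 3)) * x) = x"
    "exp (- (2 * p $ 3)) * (exp (2 * p $ 3) * x) = x" for x
    by (simp_all add: exp_minus)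
  have D: "D u = u $ 1 * D (axis 1 1) + u $ 2 * D (axis 2 1) + u $ 3 * D (axis 3 1)" for u
  proof -
    have "u = u $ 1 *\<^sub>R axis 1 1 + u $ 2 *\<^sub>R axis 2 1 + u $ 3 *\<^sub>R axis 3 1"
      by (simp add: vec_eq_iff forall_3 axis_def)
    then have "D u = D (u $ 1 *\<^sub>R axis 1 1 + u $ 2 *\<^sub>R axis 2 1 + u $ 3 *\<^sub>R axis 3 1)"
      by simp
    then show ?thesis
      by (simp add: linear_add[OF lin] linear_scale[OF lin])
  qed
  have w: "metric_inner sol_metric p ?w u = D u" for u
    by (simp add: D[of u] metric_inner_sol cancel)
  show ?thesis
    unfolding gradient_def fre
  proof (rule the_equality)
    show "\<forall>u. metric_inner sol_metric p ?w u = D u"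
      using w by simp
  next
    fix v
    assume v: "\<forall>u. metric_inner sol_metric p v u = D u"
    have "D (axis 1 1) = exp (2 * p $ 3) * v $ 1"
      "D (axis 2 1) = exp (- 2 * p $ 3) * v $ 2"
      "D (axis 3 1) = v $ 3"
      unfolding v[rule_format, symmetric] by (simp_all add: metric_inner_sol axis_def)
    then show "v = ?w"
      by (simp add: vec_eq_iff forall_3 cancel)
  qed
qed

section \<open>Energy density of a linear map and the resulting scalar equations\<close>

lemma energy_density_sol_linear:
  fixes A :: "real^3^3"
  shows "energy_density sol_metric sol_metric (\<lambda>X. A *v X) p =
    exp (- 2 * p $ 3) * (exp (2 * (A *v p) $ 3) * (A $ 1 $ 1)\<^sup>2
      + exp (- 2 * (A *v p) $ 3) * (A $ 2 $ 1)\<^sup>2 + (A $ 3 $ 1)\<^sup>2)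
    + exp (2 * p $ 3) * (exp (2 * (A *v p) $ 3) * (A $ 1 $ 2)\<^sup>2
      + exp (- 2 * (A *v p) $ 3) * (A $ 2 $ 2)\<^sup>2 + (A $ 3 $ 2)\<^sup>2)
    + (exp (2 * (A *v p) $ 3) * (A $ 1 $ 3)\<^sup>2
      + exp (- 2 * (A *v p) $ 3) * (A $ 2 $ 3)\<^sup>2 + (A $ 3 $ 3)\<^sup>2)"
  by (simp add: energy_density_def metric_trace_def pullback_metric_def matrix_inv_sol_metric
      frechet_derivative_matrix_vector_mult metric_inner_sol sum_3
      matrix_vector_mul_component[of A "axis _ _"] inner_axis power2_eq_square mult.assoc)

text \<open>The derivatives of the energy density with respect to the third coordinate \<open>w\<close> of the
  image point and with respect to the explicit occurrences of \<open>z\<close>, written in terms of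
  \<open>s = exp (2 * z)\<close> and \<open>t = exp (2 * w)\<close>.\<close>

definition image_part :: "real^3^3 \<Rightarrow> real \<Rightarrow> real \<Rightarrow> real" where
  "image_part A s t =
     2 * t * ((A $ 1 $ 1)\<^sup>2 / s + (A $ 1 $ 2)\<^sup>2 * s + (A $ 1 $ 3)\<^sup>2)
     - 2 / t * ((A $ 2 $ 1)\<^sup>2 / s + (A $ 2 $ 2)\<^sup>2 * s + (A $ 2 $ 3)\<^sup>2)"

definition source_part :: "real^3^3 \<Rightarrow> real \<Rightarrow> real \<Rightarrow> real" where
  "source_part A s t =
     2 * s * (t * (A $ 1 $ 2)\<^sup>2 + (A $ 2 $ 2)\<^sup>2 / t + (A $ 3 $ 2)\<^sup>2)
     - 2 / s * (t * (A $ 1 $ 1)\<^sup>2 + (A $ 2 $ 1)\<^sup>2 / t + (A $ 3 $ 1)\<^sup>2)"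

lemma energy_density_sol_linear_has_derivative:
  fixes A :: "real^3^3"
  shows "(energy_density sol_metric sol_metric (\<lambda>X. A *v X) has_derivative
    (\<lambda>v. (A *v v) $ 3 * image_part A (exp (2 * p $ 3)) (exp (2 * (A *v p) $ 3))
       + v $ 3 * source_part A (exp (2 * p $ 3)) (exp (2 * (A *v p) $ 3)))) (at p)"
proof -
  have z: "((\<lambda>p::real^3. p $ 3) has_derivative (\<lambda>v. v $ 3)) (at p)"
    by (rule bounded_linear_imp_has_derivative[OF bounded_linear_vec_nth])
  have w: "((\<lambda>p. (A *v p) $ 3) has_derivative (\<lambda>v. (A *v v) $ 3)) (at p)"
    by (intro bounded_linear_imp_has_derivative
        bounded_linear_compose[OF bounded_linear_vec_nth matrix_vector_mul_bounded_linear])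
  show ?thesis
    unfolding energy_density_sol_linear[abs_def]
    by (rule derivative_eq_intros z w refl)+
      (simp add: fun_eq_iff image_part_def source_part_def exp_minus field_simps)
qed

text \<open>The equation for \<open>i\<close> is row \<open>i\<close> of \<open>A\<close> applied to
  the gradient. The bracket is the inner product of rows \<open>i\<close> and \<open>3\<close> in
  the inverse metric \<open>diag (1/s, s, 1)\<close>.\<close>

lemma infinity_harmonic_sol_linear_iff:
  fixes A :: "real^3^3"
  shows "infinity_harmonic sol_metric sol_metric (\<lambda>X. A *v X) \<longleftrightarrow>
    (\<forall>p i. let s = exp (2 * p $ 3); t = exp (2 * (A *v p) $ 3) in
       (A $ i $ 1 * A $ 3 $ 1 / s + A $ i $ 2 * A $ 3 $ 2 * s + A $ i $ 3 * A $ 3 $ 3)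
         * image_part A s t + A $ i $ 3 * source_part A s t = 0)"
proof -
  have col: "(A *v axis j 1) $ 3 = A $ 3 $ j" for j
    by (simp add: matrix_vector_mul_component inner_axis)
  have "(axis j 1 :: real^3) $ 3 = (if j = 3 then 1 else 0)" for j
    by (simp add: axis_def)
  note col = col this
  have grad: "gradient sol_metric (energy_density sol_metric sol_metric (\<lambda>X. A *v X)) p =
    (let s = exp (2 * p $ 3); t = exp (2 * (A *v p) $ 3) in
      vector [A $ 3 $ 1 * image_part A s t / s, A $ 3 $ 2 * image_part A s t * s,
        A $ 3 $ 3 * image_part A s t + source_part A s t])" for p
    unfolding gradient_sol_metric[OF energy_density_sol_linear_has_derivative]
    by (simp add: col Let_def exp_minus field_simps)
  have mult_vector: "A *v vector [x, y, z] = 0 \<longleftrightarrow>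
      (\<forall>i. A $ i $ 1 * x + A $ i $ 2 * y + A $ i $ 3 * z = 0)" for x y z
    by (simp add: vec_eq_iff matrix_vector_mult_def sum_3)
  have "smooth (\<lambda>X. A *v X)"
    by (rule smooth_linear[OF matrix_vector_mul_bounded_linear])
  then show ?thesis
    unfolding infinity_harmonic_def frechet_derivative_matrix_vector_mult grad
    by (simp add: mult_vector Let_def algebra_simps add_divide_distrib)
qed

section \<open>Solving the equations according to the bottom row\<close>

text \<open>The equation for \<open>i = 3\<close> alone suffices; its bracket is \<open>S s\<close>,
  the squared length of the bottom row in the inverse metric.\<close>

lemma harmonic_bottom_row_nonzero:
  fixes A :: "real^3^3"
  assumes harm: "infinity_harmonic sol_metric sol_metric (\<lambda>X. A *v X)"
    and row: "A $ 3 $ 1 \<noteq> 0 \<or> A $ 3 $ 2 \<noteq> 0"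
  shows "A $ 3 $ 3 = 0" "A $ 1 $ j = 0" "A $ 2 $ j = 0"
proof -
  define S where "S s = (A $ 3 $ 1)\<^sup>2 / s + (A $ 3 $ 2)\<^sup>2 * s + (A $ 3 $ 3)\<^sup>2" for s
  \<comment> \<open>Since \<open>(a31, a32) \<noteq> 0\<close>, the values of \<open>z\<close> and \<open>w\<close> can be prescribed independently.\<close>
  have eq: "S s * image_part A s t + A $ 3 $ 3 * source_part A s t = 0"
    if "s > 0" "t > 0" for s t
  proof -
    \<comment> \<open>Moving by \<open>q\<close> along \<open>(a31, a32)\<close> changes
      \<open>w\<close> by \<open>q\<close> times the squared length of that vector; \<open>q\<close>
      is solved from \<open>2 * w = ln t\<close>.\<close>
    define q where "q = (ln t / 2 - A $ 3 $ 3 * (ln s / 2)) / ((A $ 3 $ 1)\<^sup>2 + (A $ 3 $ 2)\<^sup>2)"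
    define p :: "real^3" where "p = vector [q * A $ 3 $ 1, q * A $ 3 $ 2, ln s / 2]"
    have "(A $ 3 $ 1)\<^sup>2 + (A $ 3 $ 2)\<^sup>2 \<noteq> 0"
      using row by (simp add: sum_power2_eq_zero_iff)
    then have "q * ((A $ 3 $ 1)\<^sup>2 + (A $ 3 $ 2)\<^sup>2) = ln t / 2 - A $ 3 $ 3 * (ln s / 2)"
      by (simp add: q_def)
    then have w: "2 * (A *v p) $ 3 = ln t"
      by (simp add: p_def matrix_vector_mult_def sum_3 power2_eq_square algebra_simps)
    have z: "2 * p $ 3 = ln s"
      by (simp add: p_def)
    have "exp (2 * (A *v p) $ 3) = t" "exp (2 * p $ 3) = s"
      using that unfolding w z by simp_all
    then show ?thesis
      using harm[unfolded infinity_harmonic_sol_linear_iff Let_def, rule_format, of 3 p]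
      by (simp add: S_def power2_eq_square)
  qed
  \<comment> \<open>After multiplication by \<open>t\<close> this is a polynomial of degree at most
    2 with three distinct roots.\<close>
  have coeffs: "\<alpha> = 0 \<and> \<beta> = 0 \<and> \<gamma> = 0"
    if "\<And>t. t > 0 \<Longrightarrow> \<alpha> * t + \<beta> / t + \<gamma> = 0" for \<alpha> \<beta> \<gamma> :: real
    using that[of 1] that[of 2] that[of 4] by simp
  \<comment> \<open>Squared length of row \<open>i\<close> in the inverse metric, so that
    \<open>image_part A s t\<close> is \<open>2 * t * P 1 s - 2 / t * P 2 s\<close>.\<close>
  define P where "P i s = (A $ i $ 1)\<^sup>2 / s + (A $ i $ 2)\<^sup>2 * s + (A $ i $ 3)\<^sup>2" for i :: 3 and s
  have split: "S s * P 1 s + A $ 3 $ 3 * ((A $ 1 $ 2)\<^sup>2 * s - (A $ 1 $ 1)\<^sup>2 / s) = 0 \<and>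
      - S s * P 2 s + A $ 3 $ 3 * ((A $ 2 $ 2)\<^sup>2 * s - (A $ 2 $ 1)\<^sup>2 / s) = 0 \<and>
      A $ 3 $ 3 * ((A $ 3 $ 2)\<^sup>2 * s - (A $ 3 $ 1)\<^sup>2 / s) = 0" if "s > 0" for s
  proof (rule coeffs)
    fix t :: real
    assume "t > 0"
    let ?q = "(S s * P 1 s + A $ 3 $ 3 * ((A $ 1 $ 2)\<^sup>2 * s - (A $ 1 $ 1)\<^sup>2 / s)) * t
      + (- S s * P 2 s + A $ 3 $ 3 * ((A $ 2 $ 2)\<^sup>2 * s - (A $ 2 $ 1)\<^sup>2 / s)) / t
      + A $ 3 $ 3 * ((A $ 3 $ 2)\<^sup>2 * s - (A $ 3 $ 1)\<^sup>2 / s)"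
    have "2 * ?q = S s * image_part A s t + A $ 3 $ 3 * source_part A s t"
      unfolding image_part_def source_part_def P_def
      by (simp add: algebra_simps add_divide_distrib diff_divide_distrib)
    also have "\<dots> = 0"
      by (rule eq[OF that \<open>t > 0\<close>])
    finally show "?q = 0"
      by (metis mult_eq_0_iff zero_neq_numeral)
  qed
  \<comment> \<open>If \<open>a33\<close> were nonzero, the third identity in \<open>split\<close>
    would make the squares of \<open>a31\<close> and \<open>a32\<close> equal at
    \<open>s = 1\<close> and differ by a factor 4 at \<open>s = 2\<close>, so both would
    vanish.\<close>
  show a33: "A $ 3 $ 3 = 0"
    using split[of 1] split[of 2] row by auto
  have "S 1 > 0"
    using row by (auto simp: S_def a33 add_pos_nonneg add_nonneg_pos)
  then have "P 1 1 = 0" "P 2 1 = 0"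
    using split[of 1] by (auto simp: a33)
  then have "\<forall>j. A $ 1 $ j = 0" "\<forall>j. A $ 2 $ j = 0"
    by (simp_all add: P_def forall_3 add_nonneg_eq_0_iff)
  then show "A $ 1 $ j = 0" "A $ 2 $ j = 0"
    by simp_all
qed

text \<open>Only the \<open>z\<close> component of the gradient survives, so the equation for
  \<open>i\<close> says that \<open>A $ i $ 3\<close> times the \<open>z\<close>-derivative of the
  density is zero.\<close>

lemma harmonic_bottom_row_zero_iff:
  fixes A :: "real^3^3"
  assumes row: "A $ 3 $ 1 = 0" "A $ 3 $ 2 = 0"
  defines "c \<equiv> A $ 3 $ 3"
  shows "infinity_harmonic sol_metric sol_metric (\<lambda>X. A *v X) \<longleftrightarrow>
    (\<forall>i. A $ i $ 3 = 0) \<or>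
    (c - 1) * A $ 1 $ 1 = 0 \<and> (c - 1) * A $ 2 $ 2 = 0 \<and>
    (c + 1) * A $ 1 $ 2 = 0 \<and> (c + 1) * A $ 2 $ 1 = 0 \<and>
    c * A $ 1 $ 3 = 0 \<and> c * A $ 2 $ 3 = 0"
    (is "_ \<longleftrightarrow> _ \<or> ?Z")
proof -
  \<comment> \<open>The derivative of the energy density as a function of \<open>z\<close>, after
    substituting \<open>w = c * z\<close>.\<close>
  define E where "E z =
    2 * (c - 1) * (A $ 1 $ 1)\<^sup>2 * exp (2 * (c - 1) * z)
    - 2 * (c - 1) * (A $ 2 $ 2)\<^sup>2 * exp (- 2 * (c - 1) * z)
    + 2 * (c + 1) * (A $ 1 $ 2)\<^sup>2 * exp (2 * (c + 1) * z)
    - 2 * (c + 1) * (A $ 2 $ 1)\<^sup>2 * exp (- 2 * (c + 1) * z)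
    + 2 * c * (A $ 1 $ 3)\<^sup>2 * exp (2 * c * z)
    - 2 * c * (A $ 2 $ 3)\<^sup>2 * exp (- 2 * c * z)" for z
  have w: "(A *v p) $ 3 = c * p $ 3" for p
    by (simp add: matrix_vector_mult_def sum_3 row c_def)
  have ex: "exp (2 * (c - 1) * z) = exp (2 * (c * z)) / exp (2 * z)"
    "exp (- 2 * (c - 1) * z) = exp (2 * z) / exp (2 * (c * z))"
    "exp (2 * (c + 1) * z) = exp (2 * (c * z)) * exp (2 * z)"
    "exp (- 2 * (c + 1) * z) = 1 / (exp (2 * (c * z)) * exp (2 * z))"
    "exp (2 * c * z) = exp (2 * (c * z))"
    "exp (- 2 * c * z) = 1 / exp (2 * (c * z))" for z
    by (simp_all add: algebra_simps exp_add exp_diff exp_minus inverse_eq_divide)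
  have E: "c * image_part A (exp (2 * z)) (exp (2 * (c * z)))
      + source_part A (exp (2 * z)) (exp (2 * (c * z))) = E z" for z
    unfolding E_def ex image_part_def source_part_def by (simp add: row field_simps)
  have "infinity_harmonic sol_metric sol_metric (\<lambda>X. A *v X) \<longleftrightarrow>
    (\<forall>p::real^3. \<forall>i. A $ i $ 3 * E (p $ 3) = 0)"
    unfolding infinity_harmonic_sol_linear_iff Let_def w E[symmetric]
    by (simp add: row c_def algebra_simps)
  also have "\<dots> \<longleftrightarrow> (\<forall>i. A $ i $ 3 = 0) \<or> (\<forall>z. E z = 0)"
  proof -
    have "(\<forall>p::real^3. E (p $ 3) = 0) \<longleftrightarrow> (\<forall>z. E z = 0)"
      by (metis vec_component)
    then show ?thesis
      by auto
  qed
  also have "(\<forall>z. E z = 0) \<longleftrightarrow> ?Z"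
  proof
    assume "\<forall>z. E z = 0"
    then have "E = (\<lambda>_. 0)"
      by auto
    \<comment> \<open>Every term of \<open>E\<close> has the form
      \<open>k * a * a * exp (k * z)\<close>, so differentiating at 0 gives the square of
      \<open>k * a\<close> whatever the sign of \<open>k\<close>.\<close>
    moreover have "(E has_real_derivative 4 * (((c - 1) * A $ 1 $ 1)\<^sup>2 + ((c - 1) * A $ 2 $ 2)\<^sup>2
        + ((c + 1) * A $ 1 $ 2)\<^sup>2 + ((c + 1) * A $ 2 $ 1)\<^sup>2
        + (c * A $ 1 $ 3)\<^sup>2 + (c * A $ 2 $ 3)\<^sup>2)) (at 0)"
      unfolding E_def[abs_def]
      by (rule derivative_eq_intros refl)+ (simp add: power2_eq_square algebra_simps)
    ultimately have "((c - 1) * A $ 1 $ 1)\<^sup>2 + ((c - 1) * A $ 2 $ 2)\<^sup>2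
        + ((c + 1) * A $ 1 $ 2)\<^sup>2 + ((c + 1) * A $ 2 $ 1)\<^sup>2
        + (c * A $ 1 $ 3)\<^sup>2 + (c * A $ 2 $ 3)\<^sup>2 = 0"
      using DERIV_unique[OF DERIV_const[of 0]] by fastforce
    then show ?Z
      by (simp add: add_nonneg_eq_0_iff del: mult_eq_0_iff power_mult_distrib)
  next
    assume ?Z
    then show "\<forall>z. E z = 0"
      by (auto simp: E_def)
  qed
  finally show ?thesis .
qed

theorem theorem4p1:
  fixes \<phi> :: "real ^ 3 \<Rightarrow> real ^ 3"
    and a11 a12 a13 a21 a22 a23 a31 a32 a33 :: real
  assumes "\<phi> = (\<lambda>X. vector [vector [a11, a12, a13],
                            vector [a21, a22, a23],
                            vector [a31, a32, a33]] *v X)"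
  shows "infinity_harmonic sol_metric sol_metric \<phi> \<longleftrightarrow>
    (\<exists>b11 b22. \<phi> = (\<lambda>X. vector [vector [b11, 0, 0],
                               vector [0, b22, 0],
                               vector [0, 0, 1]] *v X)) \<or>
    (\<exists>b12 b21. \<phi> = (\<lambda>X. vector [vector [0, b12, 0],
                               vector [b21, 0, 0],
                               vector [0, 0, - 1]] *v X)) \<or>
    (\<exists>b11 b12 b21 b22. \<phi> = (\<lambda>X. vector [vector [b11, b12, 0],
                                       vector [b21, b22, 0],
                                       vector [0, 0, 0]] *v X)) \<or>
    (\<exists>b33. \<phi> = (\<lambda>X. vector [vector [0, 0, 0],
                           vector [0, 0, 0],
                           vector [0, 0, b33]] *v X)) \<or>
    (\<exists>b31 b32. \<phi> = (\<lambda>X. vector [vector [0, 0, 0],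
                               vector [0, 0, 0],
                               vector [b31, b32, 0]] *v X)) \<or>
    (\<exists>b13 b23. \<phi> = (\<lambda>X. vector [vector [0, 0, b13],
                               vector [0, 0, b23],
                               vector [0, 0, 0]] *v X))"
proof -
  define A :: "real^3^3" where
    "A = vector [vector [a11, a12, a13], vector [a21, a22, a23], vector [a31, a32, a33]]"
  have A [simp]:
    "A $ 1 $ 1 = a11" "A $ 1 $ 2 = a12" "A $ 1 $ 3 = a13"
    "A $ 2 $ 1 = a21" "A $ 2 $ 2 = a22" "A $ 2 $ 3 = a23"
    "A $ 3 $ 1 = a31" "A $ 3 $ 2 = a32" "A $ 3 $ 3 = a33"
    by (simp_all add: A_def)
  have \<phi>: "\<phi> = (\<lambda>X. A *v X)"
    by (simp add: assms A_def)
  have eq: "\<phi> = (\<lambda>X. B *v X) \<longleftrightarrow> A = B" for B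
    unfolding \<phi> by (simp add: fun_eq_iff matrix_eq)
  have harm: "infinity_harmonic sol_metric sol_metric \<phi> \<longleftrightarrow>
    (if a31 = 0 \<and> a32 = 0 then
       a13 = 0 \<and> a23 = 0 \<and> a33 = 0 \<or>
       (a33 - 1) * a11 = 0 \<and> (a33 - 1) * a22 = 0 \<and>
       (a33 + 1) * a12 = 0 \<and> (a33 + 1) * a21 = 0 \<and> a33 * a13 = 0 \<and> a33 * a23 = 0
     else a33 = 0 \<and> a11 = 0 \<and> a12 = 0 \<and> a13 = 0 \<and> a21 = 0 \<and> a22 = 0 \<and> a23 = 0)"
  proof (cases "a31 = 0 \<and> a32 = 0")
    case True
    then show ?thesis
      using harmonic_bottom_row_zero_iff[of A] by (simp add: \<phi> forall_3)
  next
    case False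
    \<comment> \<open>Zero first and second rows make \<open>image_part\<close> vanish, and the zero
      third column removes \<open>source_part\<close>.\<close>
    have "infinity_harmonic sol_metric sol_metric \<phi>"
      if "a33 = 0" "a11 = 0" "a12 = 0" "a13 = 0" "a21 = 0" "a22 = 0" "a23 = 0"
      unfolding \<phi> infinity_harmonic_sol_linear_iff
      by (simp add: that forall_3 image_part_def)
    moreover have "a33 = 0 \<and> a11 = 0 \<and> a12 = 0 \<and> a13 = 0 \<and> a21 = 0 \<and> a22 = 0 \<and> a23 = 0"
      if harm: "infinity_harmonic sol_metric sol_metric \<phi>"
    proof -
      have row: "A $ 3 $ 1 \<noteq> 0 \<or> A $ 3 $ 2 \<noteq> 0"
        using False by simp
      note nonzero = harmonic_bottom_row_nonzero[OF harm[unfolded \<phi>] row]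
      show ?thesis
        using nonzero(1) nonzero(2,3)[of 1] nonzero(2,3)[of 2] nonzero(2,3)[of 3] by simp
    qed
    ultimately show ?thesis
      using False by auto
  qed
  show ?thesis
    unfolding harm eq
    \<comment> \<open>The values 1, -1 and 0 of \<open>a33\<close> are those at which a factor
      \<open>a33 - 1\<close>, \<open>a33 + 1\<close> or \<open>a33\<close> vanishes and frees
      entries; any other value, with \<open>a31 = a32 = 0\<close>, leaves only \<open>a33\<close>
      itself.\<close>
    by (cases "a33 = 1"; cases "a33 = - 1"; cases "a33 = 0")
      (auto simp: vec_eq_iff[of A] vec_eq_iff[of "A $ _"] forall_3 add_eq_0_iff2)
qed

end
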